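(* Let $G$ be a group, $H$ a subgroup of finite index $[G:H]$ in $G$, and $K$ a normal subgroup of $H$. Let $C$ be a proper subset of $H$ such that $C$ is a union of right cosets of $K$ and $H\setminus C$ is a union of finitely many right cosets of $K$. Assume that the number of right cosets of $K$ contained in $C$ is greater than $2[G:H]$ times the number of right cosets of $K$ contained in $H\setminus C$. Let $E$ be a finite subset of $C$ and $F$ a subset of $H\setminus C$. Suppose that (1) $F$ is either empty or contained in a single right coset of $K$; (2) for every subset $X$ of $H$ with $|X|\leq 2([G:H]+1)|E|$, the set $F\cup X$ does not contain any right coset of $K$; (3) the set $E\cdot F^{-1}=\{ef^{-1}: e\in E, f\in F\}$ does not contain any right coset of $K$. Then $(C\setminus E)\cup F$ is not a minimal complement in $G$.
   Context: For nonempty subsets $A,B$ of a group $G$, write $A\cdot B=\{ab: a\in A, b\in B\}$. $A$ is a left complement to $B$ if $A\cdot B=G$, and a right complement to $B$ if $B\cdot A=G$. $A$ is a minimal left (resp. right) complement to $B$ if $A$ is a left (resp. right) complement to $B$ and no proper subset of $A$ is a left (resp. right) complement to $B$. A subset $A$ of $G$ is a minimal complement in $G$ if it is a minimal left complement or a minimal right complement to some nonempty subset of $G$. *)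

theory Defs
  imports "HOL-Algebra.Coset" "HOL-Library.Extended_Nat"
begin

definition left_complement :: "('a, 'b) monoid_scheme \<Rightarrow> 'a set \<Rightarrow> 'a set \<Rightarrow> bool" where
  "left_complement G A B \<longleftrightarrow>
     A \<noteq> {} \<and> A \<subseteq> carrier G \<and> B \<noteq> {} \<and> B \<subseteq> carrier G \<and> A <#>\<^bsub>G\<^esub> B = carrier G"

definition right_complement :: "('a, 'b) monoid_scheme \<Rightarrow> 'a set \<Rightarrow> 'a set \<Rightarrow> bool" where
  "right_complement G A B \<longleftrightarrow>
     A \<noteq> {} \<and> A \<subseteq> carrier G \<and> B \<noteq> {} \<and> B \<subseteq> carrier G \<and> B <#>\<^bsub>G\<^esub> A = carrier G"

definition minimal_left_complement :: "('a, 'b) monoid_scheme \<Rightarrow> 'a set \<Rightarrow> 'a set \<Rightarrow> bool" where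
  "minimal_left_complement G A B \<longleftrightarrow>
     left_complement G A B \<and> (\<forall>A'. A' \<subset> A \<longrightarrow> \<not> left_complement G A' B)"

definition minimal_right_complement :: "('a, 'b) monoid_scheme \<Rightarrow> 'a set \<Rightarrow> 'a set \<Rightarrow> bool" where
  "minimal_right_complement G A B \<longleftrightarrow>
     right_complement G A B \<and> (\<forall>A'. A' \<subset> A \<longrightarrow> \<not> right_complement G A' B)"

definition minimal_complement :: "('a, 'b) monoid_scheme \<Rightarrow> 'a set \<Rightarrow> bool" where
  "minimal_complement G A \<longleftrightarrow>
     (\<exists>B. minimal_left_complement G A B \<or> minimal_right_complement G A B)"

(* The number of right cosets of K contained in A; it may be infinite, hence enat, since card
   would give 0 for an infinite family. *)
definition num_rcosets_in :: "('a, 'b) monoid_scheme \<Rightarrow> 'a set \<Rightarrow> 'a set \<Rightarrow> enat" where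
  "num_rcosets_in G K A =
     (if finite {R \<in> rcosets\<^bsub>G\<^esub> K. R \<subseteq> A}
      then enat (card {R \<in> rcosets\<^bsub>G\<^esub> K. R \<subseteq> A}) else \<infinity>)"

end

theory Submission
  imports Defs
begin

text \<open>
  Put \<open>M = (C - E) \<union> F\<close> and suppose that \<open>M\<close> is a minimal left complement to \<open>B\<close>. By minimality every
  \<open>x \<in> M\<close> has a \<open>b = \<beta> x\<close> in \<open>B\<close> such that \<open>h x = x b\<close> has no other representation; hence
  \<open>(h x) b'\<^sup>-\<^sup>1 \<notin> M\<close> for all other \<open>b' \<in> B\<close>. Pigeonholing first inside each coset of \<open>K\<close> in \<open>C\<close> and then
  over these cosets yields one right coset of \<open>H\<close> and \<open>2m + 1\<close> cosets of \<open>K\<close> in \<open>C\<close>, where \<open>m\<close> is the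
  number of those in \<open>H - C\<close>, each with more than \<open>2|E|\<close> elements \<open>x\<close> such that \<open>\<beta> x\<close> lies in that
  coset of \<open>H\<close>. It contains two distinct elements \<open>b1\<close>, \<open>b2\<close> of \<open>B\<close>, because \<open>M \<noteq> H\<close>.

  The map \<open>h\<close> is injective. If \<open>a1 \<noteq> a2\<close> are in \<open>B\<close> and \<open>(h x) a1\<^sup>-\<^sup>1\<close>, \<open>(h x) a2\<^sup>-\<^sup>1\<close> both lie in \<open>C\<close>, then one
  of them lies in \<open>E\<close>, so this occurs for at most \<open>2|E|\<close> of the \<open>x\<close>. In particular all but \<open>2|E|\<close> of
  the \<open>h x\<close> lie in the at most \<open>2m\<close> cosets of \<open>K\<close> that make up \<open>(H - C) b1\<close> and \<open>(H - C) b2\<close>; and for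
  each of these cosets, either at most \<open>2|E|\<close> of the \<open>x\<close> are mapped into it, or \<open>\<beta>\<close> is constant on
  those \<open>x\<close>, which then lie in a single coset of \<open>K\<close>. This leaves no room for \<open>2m + 1\<close> cosets with more
  than \<open>2|E|\<close> elements each. Right complements reduce to left ones by inversion, as \<open>K\<close> is normal
  in \<open>H\<close>.
\<close>

section \<open>Counting in the fibres of a map\<close>

lemma pigeonhole_fibre:
  assumes "finite I" "f ` T \<subseteq> I" "q * card I < card T"
  shows "\<exists>i\<in>I. q < card {t \<in> T. f t = i}"
proof (rule ccontr)
  assume "\<not> ?thesis"
  then have *: "card {t \<in> T. f t = i} \<le> q" if "i \<in> I" for i
    using that by auto
  have "T = (\<Union>i\<in>I. {t \<in> T. f t = i})"
    using assms(2) by auto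
  then have "card T = card (\<Union>i\<in>I. {t \<in> T. f t = i})"
    by (rule arg_cong)
  also have "\<dots> \<le> (\<Sum>i\<in>I. card {t \<in> T. f t = i})"
    using assms(1) by (rule card_UN_le)
  also have "\<dots> \<le> card I * q"
    using sum_bounded_above[of I "\<lambda>i. card {t \<in> T. f t = i}" q] * by simp
  finally show False
    using assms(3) by (simp add: mult.commute)
qed

text \<open>
  The exceptional set \<open>Z\<close> does not enlarge the bound: with \<open>l\<close> small sets \<open>A i\<close>, the large fibres not
  taken care of by the other \<open>A i\<close> have at least \<open>q + 1\<close> elements each, and at most \<open>(l + 1) q\<close> in total.
\<close>

lemma card_large_fibres_le:
  assumes "finite S" "finite I" "finite J"
    and cover: "S \<subseteq> Z \<union> (\<Union>i\<in>I. A i)"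
    and sub: "Z \<subseteq> S" "\<And>i. i \<in> I \<Longrightarrow> A i \<subseteq> S"
    and Z: "card Z \<le> q"
    and A: "\<And>i. i \<in> I \<Longrightarrow> card (A i) \<le> q \<or> (\<forall>x\<in>A i. \<forall>y\<in>A i. f x = f y)"
    and J: "\<And>j. j \<in> J \<Longrightarrow> q < card {x \<in> S. f x = j}"
  shows "card J \<le> card I"
proof -
  define I1 where "I1 = {i \<in> I. \<forall>x\<in>A i. \<forall>y\<in>A i. f x = f y}"
  \<comment> \<open>The constant values of \<open>f\<close> on the sets indexed by
    \<open>I1\<close>. For an empty \<open>A i\<close> the choice adds an arbitrary value, which
    \<open>card J1 \<le> card I1\<close> still accounts for.\<close>
  define J1 where "J1 = (\<lambda>i. f (SOME x. x \<in> A i)) ` I1"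
  define U where "U = Z \<union> (\<Union>i\<in>I - I1. A i)"
  have fin: "finite I1" "finite J1" "finite U"
    using assms(1,2) sub finite_subset[OF _ assms(1)] by (auto simp: I1_def J1_def U_def)
  have J1: "f x \<in> J1" if "i \<in> I1" "x \<in> A i" for i x
  proof -
    have "(SOME x. x \<in> A i) \<in> A i" using that(2) by (rule someI)
    then have "f x = f (SOME x. x \<in> A i)" using that unfolding I1_def by blast
    then show ?thesis using that(1) unfolding J1_def by (rule image_eqI)
  qed
  have fibre: "{x \<in> S. f x = j} \<subseteq> U" if j: "j \<in> J - J1" for j
  proof
    fix x assume x: "x \<in> {x \<in> S. f x = j}"
    then consider "x \<in> Z" | i where "i \<in> I" "x \<in> A i" using cover by blast
    then show "x \<in> U"
    proof cases
      case 2
      then have "i \<notin> I1" using J1[of i x] j x by auto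
      then show ?thesis using 2 by (auto simp: U_def)
    qed (auto simp: U_def)
  qed
  have "card J1 \<le> card I1"
    unfolding J1_def by (rule card_image_le[OF fin(1)])
  have "card J \<le> card (J1 \<union> (J - J1))"
    using fin assms(3) by (intro card_mono) auto
  also have "\<dots> \<le> card J1 + card (J - J1)" by (rule card_Un_le)
  finally have cJ: "card J \<le> card I1 + card (J - J1)"
    using \<open>card J1 \<le> card I1\<close> by simp
  have cI: "card I = card I1 + card (I - I1)"
    using assms(2) fin(1) by (metis (no_types, lifting) I1_def card_Diff_subset card_mono le_add_diff_inverse mem_Collect_eq subsetI)
  have "card (A i) \<le> q" if "i \<in> I - I1" for i
    using A[of i] that unfolding I1_def by blast
  then have "(\<Sum>i\<in>I - I1. card (A i)) \<le> card (I - I1) * q"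
    using sum_bounded_above[of "I - I1" "\<lambda>i. card (A i)" q] by simp
  moreover have "card (\<Union>i\<in>I - I1. A i) \<le> (\<Sum>i\<in>I - I1. card (A i))"
    using assms(2) by (intro card_UN_le) auto
  moreover have "card U \<le> card Z + card (\<Union>i\<in>I - I1. A i)"
    unfolding U_def by (rule card_Un_le)
  ultimately have U: "card U \<le> (card (I - I1) + 1) * q"
    using Z by simp
  have "card (J - J1) * (q + 1) \<le> (\<Sum>j\<in>J - J1. card {x \<in> S. f x = j})"
    using sum_bounded_below[of "J - J1" "q + 1" "\<lambda>j. card {x \<in> S. f x = j}"] J
    by (force simp: Suc_le_eq)
  also have "\<dots> = card (\<Union>j\<in>J - J1. {x \<in> S. f x = j})"
    using assms(1,3) by (intro card_UN_disjoint[symmetric]) auto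
  also have "\<dots> \<le> card U"
    using fibre fin(3) by (intro card_mono) auto
  finally have *: "card (J - J1) * (q + 1) \<le> (card (I - I1) + 1) * q"
    using U by simp
  have "card (J - J1) \<le> card (I - I1)"
  proof (rule ccontr)
    assume "\<not> ?thesis"
    then have "(card (I - I1) + 1) * (q + 1) \<le> card (J - J1) * (q + 1)"
      by (intro mult_right_mono) auto
    with * show False by simp
  qed
  with cJ cI show ?thesis by simp
qed

section \<open>Large cosets of \<open>K\<close> over one coset of \<open>H\<close>\<close>

context group
begin

lemma rcos_mult_cong:
  assumes "subgroup K G" "x \<in> carrier G" "y \<in> carrier G" "c \<in> carrier G" "K #> x = K #> y"
  shows "K #> (x \<otimes> c) = K #> (y \<otimes> c)"
  using assms by (metis coset_mult_assoc subgroup.subset)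

lemma rcos_closed_mem:
  assumes "subgroup K G" "C \<subseteq> carrier G" "\<And>k x. k \<in> K \<Longrightarrow> x \<in> C \<Longrightarrow> k \<otimes> x \<in> C"
    and "x \<in> C" "y \<in> carrier G" "K #> x = K #> y"
  shows "y \<in> C"
proof -
  have "y \<in> K #> x" using assms by (metis rcos_self)
  then show ?thesis using assms(3,4) by (auto simp: r_coset_def)
qed

text \<open>\<open>B\<close> is the part of the complement in one coset of \<open>H\<close>, so
  every \<open>h x \<otimes> inv b\<close> lies in \<open>H\<close>. The fibres counted are those of
  \<open>x \<mapsto> K #> x\<close>; the small sets \<open>A R\<close> collect the \<open>x\<close>
  with \<open>h x\<close> in \<open>R\<close>, for \<open>R\<close> in a family that covers
  \<open>(H - C) b1\<close> and \<open>(H - C) b2\<close>.\<close>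

lemma card_large_cosets_le:
  assumes H: "subgroup H G" and K: "subgroup K G"
    and C: "C \<subseteq> H" and KC: "\<And>k x. k \<in> K \<Longrightarrow> x \<in> C \<Longrightarrow> k \<otimes> x \<in> C"
    and Y: "finite Y" "Y \<subseteq> H" "H - C \<subseteq> (\<Union>y\<in>Y. K #> y)"
    and E: "finite (C - M)"
    and B: "B \<subseteq> carrier G" "\<And>b b'. b \<in> B \<Longrightarrow> b' \<in> B \<Longrightarrow> b \<otimes> inv b' \<in> H"
    and b12: "b1 \<in> B" "b2 \<in> B" "b1 \<noteq> b2"
    and S: "finite S" "S \<subseteq> C \<inter> M"
    and \<beta>: "\<And>x. x \<in> S \<Longrightarrow> \<beta> x \<in> B"
      "\<And>x b. x \<in> S \<Longrightarrow> b \<in> B \<Longrightarrow> b \<noteq> \<beta> x \<Longrightarrow> x \<otimes> \<beta> x \<otimes> inv b \<notin> M"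
    and J: "finite J" "\<And>R. R \<in> J \<Longrightarrow> 2 * card (C - M) < card {x \<in> S. K #> x = R}"
  shows "card J \<le> 2 * card Y"
proof -
  define h where "h = (\<lambda>x. x \<otimes> \<beta> x)"
  define W where "W = (\<lambda>a b. {x \<in> S. h x \<otimes> inv a \<in> C - M \<or> h x \<otimes> inv b \<in> C - M})"
  define N where "N = (\<lambda>y. K #> (y \<otimes> b1)) ` Y \<union> (\<lambda>y. K #> (y \<otimes> b2)) ` Y"
  have Hc: "H \<subseteq> carrier G" using H by (rule subgroup.subset)
  have Bc: "b \<in> carrier G" if "b \<in> B" for b using that B by auto
  have Sc: "x \<in> carrier G" "x \<in> H" "x \<in> C" "x \<in> M" if "x \<in> S" for x using that S C Hc by auto
  have hc: "h x \<in> carrier G" if "x \<in> S" for x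
    using that Sc Bc \<beta> by (auto simp: h_def)
  have h_back: "h x \<otimes> inv (\<beta> x) = x" if "x \<in> S" for x
    using that Sc Bc \<beta> by (auto simp: h_def m_assoc)
  have hH: "h x \<otimes> inv b \<in> H" if "x \<in> S" "b \<in> B" for x b
  proof -
    have "h x \<otimes> inv b = x \<otimes> (\<beta> x \<otimes> inv b)"
      using that Sc Bc \<beta> by (auto simp: h_def m_assoc)
    then show ?thesis using that Sc B \<beta> H by (auto intro: subgroup.m_closed)
  qed
  \<comment> \<open>If \<open>\<beta> x \<noteq> \<beta> y\<close>, then
    \<open>h x \<otimes> inv (\<beta> y) = y\<close> lies in \<open>M\<close>, against the choice of
    \<open>\<beta> x\<close>.\<close>
  have inj: "x = y" if "x \<in> S" "y \<in> S" "h x = h y" for x y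
  proof (cases "\<beta> x = \<beta> y")
    case True
    then show ?thesis using that h_back by metis
  next
    case False
    then have "h x \<otimes> inv (\<beta> y) \<notin> M"
      unfolding h_def using that \<beta> by metis
    then show ?thesis using that h_back Sc by metis
  qed
  have card_half: "card {x \<in> S. h x \<otimes> inv a \<in> C - M} \<le> card (C - M)" if "a \<in> B" for a
  proof (rule card_inj_on_le[of "\<lambda>x. h x \<otimes> inv a"])
    show "inj_on (\<lambda>x. h x \<otimes> inv a) {x \<in> S. h x \<otimes> inv a \<in> C - M}"
      using that inj hc Bc by (auto simp: inj_on_def)
  qed (use E in auto)
  have card_W: "card (W a b) \<le> 2 * card (C - M)" if "a \<in> B" "b \<in> B" for a b
  proof -
    have "W a b = {x \<in> S. h x \<otimes> inv a \<in> C - M} \<union> {x \<in> S. h x \<otimes> inv b \<in> C - M}"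
      by (auto simp: W_def)
    then have "card (W a b) \<le> card {x \<in> S. h x \<otimes> inv a \<in> C - M} + card {x \<in> S. h x \<otimes> inv b \<in> C - M}"
      by (simp only: card_Un_le)
    then show ?thesis using card_half[OF that(1)] card_half[OF that(2)] by linarith
  qed
  \<comment> \<open>One of \<open>a\<close>, \<open>b\<close> differs from \<open>\<beta> x\<close>;
    the quotient of \<open>h x\<close> by it avoids \<open>M\<close>, hence lies in
    \<open>C - M\<close>.\<close>
  have W_mem: "x \<in> W a b"
    if "x \<in> S" "a \<in> B" "b \<in> B" "a \<noteq> b" "h x \<otimes> inv a \<in> C" "h x \<otimes> inv b \<in> C" for x a b
  proof (cases "a = \<beta> x")
    case True
    then have "h x \<otimes> inv b \<notin> M" unfolding h_def using that \<beta> by metis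
    then show ?thesis using that by (auto simp: W_def)
  next
    case False
    then have "h x \<otimes> inv a \<notin> M" unfolding h_def using that \<beta> by metis
    then show ?thesis using that by (auto simp: W_def)
  qed
  have N_mem: "K #> h x \<in> (\<lambda>y. K #> (y \<otimes> b)) ` Y"
    if xb: "x \<in> S" "b \<in> B" "h x \<otimes> inv b \<notin> C" for x b
  proof -
    obtain y where y: "y \<in> Y" "h x \<otimes> inv b \<in> K #> y"
      using Y(3) hH[OF xb(1,2)] xb(3) by blast
    have yc: "y \<in> carrier G" using y Y(2) Hc by auto
    have "K #> y = K #> (h x \<otimes> inv b)"
      using y yc K by (intro repr_independence) auto
    then have "K #> (y \<otimes> b) = K #> (h x \<otimes> inv b \<otimes> b)"
      using K yc Bc[OF that(2)] hc[OF that(1)] by (intro rcos_mult_cong) auto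
    also have "h x \<otimes> inv b \<otimes> b = h x"
      using Bc[OF that(2)] hc[OF that(1)] by (simp add: m_assoc)
    finally show ?thesis using y by auto
  qed
  have "card J \<le> card N"
  proof (rule card_large_fibres_le[where Z = "W b1 b2" and A = "\<lambda>R. {x \<in> S. K #> h x = R}"
        and q = "2 * card (C - M)" and f = "\<lambda>x. K #> x" and S = S])
    show "S \<subseteq> W b1 b2 \<union> (\<Union>R\<in>N. {x \<in> S. K #> h x = R})"
    proof
      fix x assume x: "x \<in> S"
      show "x \<in> W b1 b2 \<union> (\<Union>R\<in>N. {x \<in> S. K #> h x = R})"
      proof (cases "h x \<otimes> inv b1 \<in> C \<and> h x \<otimes> inv b2 \<in> C")
        case True
        then show ?thesis using W_mem[OF x b12] by blast
      next
        case False
        then have "K #> h x \<in> N"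
          using N_mem[OF x b12(1)] N_mem[OF x b12(2)] unfolding N_def by blast
        then show ?thesis using x by blast
      qed
    qed
    fix R
    show "card {x \<in> S. K #> h x = R} \<le> 2 * card (C - M) \<or>
      (\<forall>x\<in>{x \<in> S. K #> h x = R}. \<forall>y\<in>{x \<in> S. K #> h x = R}. K #> x = K #> y)"
    proof (cases "\<exists>x\<in>S. \<exists>y\<in>S. K #> h x = R \<and> K #> h y = R \<and> \<beta> x \<noteq> \<beta> y")
      case True
      then obtain x y where xy: "x \<in> S" "y \<in> S" "K #> h x = R" "K #> h y = R" "\<beta> x \<noteq> \<beta> y"
        by auto
      \<comment> \<open>Dividing \<open>K #> h w\<close> by \<open>\<beta> w\<close> gives the coset
        of \<open>w\<close>, which is part of \<open>C\<close>. As \<open>h z\<close> is in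
        \<open>K #> h w\<close>, its quotient lands there too, even if
        \<open>\<beta> z \<noteq> \<beta> w\<close>. Two values of \<open>\<beta>\<close> thus force
        the whole fibre over \<open>R\<close> into \<open>W\<close>.\<close>
      have inC: "h z \<otimes> inv (\<beta> w) \<in> C" if "z \<in> S" "w \<in> S" "K #> h z = K #> h w" for z w
      proof (rule rcos_closed_mem[OF K _ KC])
        show "K #> w = K #> (h z \<otimes> inv (\<beta> w))"
          using rcos_mult_cong[OF K, of "h w" "h z" "inv (\<beta> w)"] that hc Bc \<beta> h_back by simp
      qed (use that hc Bc \<beta> C Hc Sc in auto)
      have "{x \<in> S. K #> h x = R} \<subseteq> W (\<beta> x) (\<beta> y)"
        using W_mem \<beta>(1) inC xy by auto
      then have "card {x \<in> S. K #> h x = R} \<le> card (W (\<beta> x) (\<beta> y))"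
        using S(1) by (intro card_mono) (auto simp: W_def)
      then show ?thesis using card_W[of "\<beta> x" "\<beta> y"] xy \<beta>(1) by simp
    next
      case False
      \<comment> \<open>Dividing \<open>R\<close> by the common value of \<open>\<beta>\<close>
        gives a single coset, which contains both \<open>x\<close> and \<open>y\<close>.\<close>
      have "K #> x = K #> y" if "x \<in> S" "y \<in> S" "K #> h x = R" "K #> h y = R" for x y
      proof -
        have "\<beta> x = \<beta> y" using False that by blast
        then have "K #> (h x \<otimes> inv (\<beta> x)) = K #> (h y \<otimes> inv (\<beta> y))"
          using rcos_mult_cong[OF K, of "h x" "h y" "inv (\<beta> x)"] that hc Bc \<beta>(1) by simp
        then show ?thesis using h_back that by simp
      qed
      then show ?thesis by auto
    qed
  qed (use S J Y b12 card_W in \<open>auto simp: N_def W_def\<close>)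
  also have "card N \<le> card ((\<lambda>y. K #> (y \<otimes> b1)) ` Y) + card ((\<lambda>y. K #> (y \<otimes> b2)) ` Y)"
    unfolding N_def by (rule card_Un_le)
  also have "\<dots> \<le> card Y + card Y"
    using Y(1) by (intro add_mono card_image_le)
  finally show ?thesis by simp
qed

section \<open>Left complements\<close>

text \<open>Without \<open>x\<close> some \<open>g\<close> is no longer covered, so
  \<open>g = x \<otimes> b\<close> and all its representations start with \<open>x\<close>.
  Membership of \<open>x \<otimes> b \<otimes> inv b'\<close> in \<open>M\<close> would give one
  that does not.\<close>

lemma minimal_left_complement_unique_rep:
  assumes "minimal_left_complement G M B" "x \<in> M"
  shows "\<exists>b\<in>B. \<forall>b'\<in>B. b' \<noteq> b \<longrightarrow> x \<otimes> b \<otimes> inv b' \<notin> M"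
proof -
  have M: "M \<subseteq> carrier G" "B \<subseteq> carrier G" "B \<noteq> {}" "M <#> B = carrier G"
    using assms by (auto simp: minimal_left_complement_def left_complement_def)
  have "\<not> left_complement G (M - {x}) B"
    using assms by (auto simp: minimal_left_complement_def)
  then have "(M - {x}) <#> B \<noteq> carrier G"
    using M by (auto simp: left_complement_def set_mult_def)
  moreover have "(M - {x}) <#> B \<subseteq> carrier G"
    using M by (auto simp: set_mult_def)
  ultimately obtain g where g: "g \<in> carrier G" "g \<notin> (M - {x}) <#> B" by blast
  then obtain x' b where xb: "x' \<in> M" "b \<in> B" "g = x' \<otimes> b"
    using M(4)[symmetric] by (force simp: set_mult_def)
  then have "x' = x" using g by (auto simp: set_mult_def)
  have "x \<otimes> b \<otimes> inv b' \<notin> M" if "b' \<in> B" "b' \<noteq> b" for b'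
  proof
    assume *: "x \<otimes> b \<otimes> inv b' \<in> M"
    have c: "x \<in> carrier G" "b \<in> carrier G" "b' \<in> carrier G"
      using that assms(2) M xb by auto
    have "g = (x \<otimes> b \<otimes> inv b') \<otimes> b'"
      using c xb \<open>x' = x\<close> by (simp add: m_assoc)
    then have "x \<otimes> b \<otimes> inv b' = x" using g(2) * that by (auto simp: set_mult_def)
    then have "b \<otimes> inv b' = \<one>" using c by (simp add: m_assoc)
    then have "b = b'" using c by (metis inv_equality inv_inv inv_closed)
    then show False using that by simp
  qed
  then show ?thesis using xb by auto
qed

text \<open>\<open>M\<close> stands for \<open>(C - E) \<union> F\<close>, so \<open>C - M\<close>
  is \<open>E\<close>; \<open>X\<close> represents distinct cosets of \<open>K\<close> in
  \<open>C\<close>, and the cosets of \<open>Y\<close> cover \<open>H - C\<close>. Two pigeonholes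
  prepare the contradiction with \<open>card_large_cosets_le\<close>.\<close>

lemma not_minimal_left_complement:
  assumes H: "subgroup H G" and finH: "finite (rcosets H)"
    and K: "subgroup K G" "K \<subseteq> H"
    and C: "C \<subseteq> H" and KC: "\<And>k x. k \<in> K \<Longrightarrow> x \<in> C \<Longrightarrow> k \<otimes> x \<in> C"
    and Y: "finite Y" "Y \<subseteq> H" "H - C \<subseteq> (\<Union>y\<in>Y. K #> y)"
    and X: "X \<subseteq> C" "inj_on (\<lambda>x. K #> x) X" "2 * card (rcosets H) * card Y < card X"
    and M: "M \<subset> H" and E: "finite (C - M)"
    and cardK: "infinite K \<or> 2 * (card (rcosets H) + 1) * card (C - M) < card K"
  shows "\<not> minimal_left_complement G M B"
proof
  assume min: "minimal_left_complement G M B"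
  define n where "n = card (rcosets H)"
  define e where "e = card (C - M)"
  have MB: "M \<subseteq> carrier G" "B \<subseteq> carrier G" "M <#> B = carrier G"
    using min by (auto simp: minimal_left_complement_def left_complement_def)
  have Hc: "H \<subseteq> carrier G" and Kc: "K \<subseteq> carrier G"
    using H K by (simp_all add: subgroup.subset)
  have finX: "finite X" using X(3) by (metis card.infinite not_less_zero)
  obtain \<beta> where \<beta>: "\<And>x. x \<in> M \<Longrightarrow> \<beta> x \<in> B"
    "\<And>x b. x \<in> M \<Longrightarrow> b \<in> B \<Longrightarrow> b \<noteq> \<beta> x \<Longrightarrow> x \<otimes> \<beta> x \<otimes> inv b \<notin> M"
    using minimal_left_complement_unique_rep[OF min] by metis
  define P where "P = (\<lambda>x R T. finite T \<and> T \<subseteq> C \<inter> M \<and> 2 * e < card T \<and>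
      (\<forall>z\<in>T. K #> z = K #> x \<and> H #> \<beta> z = R))"
  have big: "\<exists>R. R \<in> rcosets H \<and> (\<exists>T. P x R T)" if "x \<in> X" for x
  proof -
    have xC: "x \<in> C" "x \<in> carrier G" using that X C Hc by auto
    \<comment> \<open>\<open>K\<close> may be infinite, hence a finite part. Discarding
      \<open>C - M\<close> costs at most \<open>e\<close> elements and leaves more than
      \<open>2 * e * n\<close>, so one of the \<open>n\<close> cosets of \<open>H\<close> receives
      more than \<open>2 * e\<close>.\<close>
    obtain K' where K': "K' \<subseteq> K" "finite K'" "2 * (n + 1) * e < card K'"
      using cardK infinite_arbitrarily_large[of K "Suc (2 * (n + 1) * e)"]
        card.infinite[of K] unfolding n_def e_def by (metis lessI not_less_zero subset_refl)
    define T where "T = (\<lambda>k. k \<otimes> x) ` K' - (C - M)"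
    have "card ((\<lambda>k. k \<otimes> x) ` K') = card K'"
      using K' xC Kc by (intro card_image inj_onI) (metis right_cancel subsetD)
    moreover have "card ((\<lambda>k. k \<otimes> x) ` K') - card (C - M) \<le> card T"
      unfolding T_def using E by (rule diff_card_le_card_Diff)
    ultimately have "2 * e * n < card T"
      using K'(3) by (simp add: e_def algebra_simps)
    moreover have TCM: "T \<subseteq> C \<inter> M"
      using K' KC xC by (auto simp: T_def)
    moreover have "(\<lambda>z. H #> \<beta> z) ` T \<subseteq> rcosets H"
      using TCM \<beta>(1) MB(2) Hc by (blast intro: rcosetsI)
    ultimately obtain R where R: "R \<in> rcosets H" "2 * e < card {z \<in> T. H #> \<beta> z = R}"
      using pigeonhole_fibre[OF finH, of "\<lambda>z. H #> \<beta> z" T "2 * e"] by (auto simp: n_def)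
    have "K #> z = K #> x" if "z \<in> T" for z
    proof -
      have "z \<in> K #> x" using that K' by (auto simp: T_def r_coset_def)
      then show ?thesis using K xC repr_independence by metis
    qed
    moreover have "finite T" using K' by (auto simp: T_def)
    ultimately show ?thesis
      using R TCM unfolding P_def
      by (intro exI[of _ R] conjI exI[of _ "{z \<in> T. H #> \<beta> z = R}"]) auto
  qed
  obtain r where r: "\<forall>x\<in>X. r x \<in> rcosets H \<and> (\<exists>T. P x (r x) T)"
    using bchoice[of X "\<lambda>x R. R \<in> rcosets H \<and> (\<exists>T. P x R T)"] big by blast
  then obtain T where "\<forall>x\<in>X. P x (r x) (T x)"
    using bchoice[of X "\<lambda>x T. P x (r x) T"] by blast
  with r have rT: "\<And>x. x \<in> X \<Longrightarrow> r x \<in> rcosets H" "\<And>x. x \<in> X \<Longrightarrow> finite (T x)"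
    "\<And>x. x \<in> X \<Longrightarrow> T x \<subseteq> C \<inter> M" "\<And>x. x \<in> X \<Longrightarrow> 2 * e < card (T x)"
    "\<And>x z. x \<in> X \<Longrightarrow> z \<in> T x \<Longrightarrow> K #> z = K #> x"
    "\<And>x z. x \<in> X \<Longrightarrow> z \<in> T x \<Longrightarrow> H #> \<beta> z = r x"
    unfolding P_def by blast+
  \<comment> \<open>Second pigeonhole: the representatives in \<open>X\<close> are sorted by the
    coset of \<open>H\<close> found for each.\<close>
  have "\<exists>R\<in>rcosets H. 2 * card Y < card {x \<in> X. r x = R}"
    using rT(1) X(3) by (intro pigeonhole_fibre[OF finH]) (auto simp: ac_simps)
  then obtain R where R: "R \<in> rcosets H" "2 * card Y < card {x \<in> X. r x = R}" by blast
  define B' where "B' = B \<inter> R"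
  define X' where "X' = {x \<in> X. r x = R}"
  obtain g where g: "g \<in> carrier G" "R = H #> g"
    using R(1) by (auto simp: RCOSETS_def)
  \<comment> \<open>As \<open>M\<close> lies in \<open>H\<close>, the elements of \<open>R\<close>
    can only be represented with second factor in \<open>B'\<close>.\<close>
  have memR: "b \<in> R" if "x \<in> H" "b \<in> carrier G" "x \<otimes> b \<in> R" for x b
  proof -
    have "x \<otimes> b \<in> H #> b" using that by (auto simp: r_coset_def)
    then have "H #> b = H #> (x \<otimes> b)" using that H by (intro repr_independence)
    moreover have "H #> g = H #> (x \<otimes> b)" using that g H by (intro repr_independence) auto
    ultimately show ?thesis using that g H rcos_self by metis
  qed
  have rep: "\<exists>x\<in>M. \<exists>b\<in>B'. u = x \<otimes> b" if "u \<in> R" for u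
  proof -
    have "u \<in> carrier G" using that g Hc by (auto simp: r_coset_def)
    then obtain x b where "x \<in> M" "b \<in> B" "u = x \<otimes> b"
      using MB(3)[symmetric] by (force simp: set_mult_def)
    then show ?thesis using memR[of x b] M MB that unfolding B'_def by blast
  qed
  have "g \<in> R" using g H rcos_self by metis
  then obtain b1 where b1: "b1 \<in> B'" using rep by blast
  have b1c: "b1 \<in> carrier G" using b1 MB by (auto simp: B'_def)
  \<comment> \<open>A second element of \<open>B'\<close>: since \<open>y \<notin> M\<close>, the
    element \<open>y \<otimes> b1\<close> of \<open>R\<close> needs a representation with second
    factor other than \<open>b1\<close>.\<close>
  obtain y where y: "y \<in> H" "y \<notin> M" using M by auto
  have "y \<otimes> b1 \<in> R"
  proof -
    have "H #> g = H #> b1" using b1 g H by (intro repr_independence) (auto simp: B'_def)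
    then show ?thesis using y g by (auto simp: r_coset_def)
  qed
  then obtain x b2 where b2: "x \<in> M" "b2 \<in> B'" "y \<otimes> b1 = x \<otimes> b2" using rep by blast
  have "b1 \<noteq> b2"
    using b2 y b1c Hc MB(1) by (metis right_cancel subsetD)
  have "card ((\<lambda>x. K #> x) ` X') \<le> 2 * card Y"
  proof (rule card_large_cosets_le[OF H K(1) C _ Y E, of B' b1 b2 "\<Union>x\<in>X'. T x" \<beta>])
    fix b b' assume "b \<in> B'" "b' \<in> B'"
    then have b: "b \<in> carrier G" "b' \<in> carrier G" "b \<in> H #> g" "b' \<in> H #> g"
      using MB by (auto simp: B'_def g)
    then have "b \<in> H #> b'" using g H repr_independence by metis
    then obtain u where u: "u \<in> H" "b = u \<otimes> b'" by (auto simp: r_coset_def)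
    then show "b \<otimes> inv b' \<in> H" using b Hc by (auto simp: m_assoc)
  next
    fix x assume "x \<in> (\<Union>x\<in>X'. T x)"
    then obtain w where w: "w \<in> X" "r w = R" "x \<in> T w" by (auto simp: X'_def)
    then have "x \<in> M" using rT(3) by blast
    then have x: "\<beta> x \<in> B" "H #> \<beta> x = R" using \<beta>(1) rT(6)[OF w(1,3)] w(2) by auto
    then have "\<beta> x \<in> H #> \<beta> x" using MB(2) H by (intro rcos_self) auto
    then show "\<beta> x \<in> B'" using x by (simp add: B'_def)
  next
    fix Q assume "Q \<in> (\<lambda>x. K #> x) ` X'"
    then obtain w where w: "w \<in> X'" "Q = K #> w" by auto
    then have "T w \<subseteq> {x \<in> \<Union>x\<in>X'. T x. K #> x = Q}" using rT(5) by (auto simp: X'_def)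
    then have "card (T w) \<le> card {x \<in> \<Union>x\<in>X'. T x. K #> x = Q}"
      using rT(2) finX by (intro card_mono) (auto simp: X'_def)
    then show "2 * card (C - M) < card {x \<in> \<Union>x\<in>X'. T x. K #> x = Q}"
      using rT(4)[of w] w by (auto simp: X'_def e_def)
  next
    fix x b assume "x \<in> (\<Union>x\<in>X'. T x)" "b \<in> B'" "b \<noteq> \<beta> x"
    then show "x \<otimes> \<beta> x \<otimes> inv b \<notin> M"
      using \<beta>(2) rT(3) by (fastforce simp: X'_def B'_def)
  next
    show "finite (\<Union>x\<in>X'. T x)" "(\<Union>x\<in>X'. T x) \<subseteq> C \<inter> M" "finite ((\<lambda>x. K #> x) ` X')"
      using finX rT(2,3) by (auto simp: X'_def)
    show "B' \<subseteq> carrier G" using MB(2) by (auto simp: B'_def)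
  qed (use KC b1 b2(2) \<open>b1 \<noteq> b2\<close> in simp_all)
  moreover have "card ((\<lambda>x. K #> x) ` X') = card X'"
    using X(2) by (intro card_image) (auto simp: X'_def inj_on_def)
  ultimately show False using R(2) by (simp add: X'_def)
qed

section \<open>Inversion and right complements\<close>

lemma set_inv_eq_image: "set_inv A = (\<lambda>x. inv x) ` A"
  by (auto simp: SET_INV_def)

lemma set_inv_set_inv:
  assumes "A \<subseteq> carrier G"
  shows "set_inv (set_inv A) = A"
  using assms by (force simp: set_inv_eq_image image_image)

lemma set_inv_set_mult:
  assumes "A \<subseteq> carrier G" "B \<subseteq> carrier G"
  shows "set_inv (A <#> B) = set_inv B <#> set_inv A"
proof -
  have "inv (a \<otimes> b) = inv b \<otimes> inv a" if "a \<in> A" "b \<in> B" for a b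
    using that assms by (meson inv_mult_group subsetD)
  then show ?thesis by (fastforce simp: SET_INV_def set_mult_def)
qed

lemma set_inv_carrier: "set_inv (carrier G) = carrier G"
proof
  show "carrier G \<subseteq> set_inv (carrier G)"
    by (metis image_eqI inv_closed inv_inv set_inv_eq_image subsetI)
qed (auto simp: set_inv_eq_image)

lemma left_complement_set_inv:
  assumes "right_complement G A B"
  shows "left_complement G (set_inv A) (set_inv B)"
proof -
  have "A \<subseteq> carrier G" "B \<subseteq> carrier G" "B <#> A = carrier G" "A \<noteq> {}" "B \<noteq> {}"
    using assms by (auto simp: right_complement_def)
  moreover have "set_inv (carrier G) = carrier G"
    by (rule set_inv_carrier)
  ultimately show ?thesis
    using set_inv_set_mult[of B A] unfolding left_complement_def
    by (metis image_is_empty image_mono set_inv_eq_image)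
qed

lemma right_complement_set_inv:
  assumes "left_complement G A B"
  shows "right_complement G (set_inv A) (set_inv B)"
proof -
  have "A \<subseteq> carrier G" "B \<subseteq> carrier G" "A <#> B = carrier G" "A \<noteq> {}" "B \<noteq> {}"
    using assms by (auto simp: left_complement_def)
  moreover have "set_inv (carrier G) = carrier G"
    by (rule set_inv_carrier)
  ultimately show ?thesis
    using set_inv_set_mult[of A B] unfolding right_complement_def
    by (metis image_is_empty image_mono set_inv_eq_image)
qed

lemma minimal_left_complement_set_inv:
  assumes "minimal_right_complement G A B"
  shows "minimal_left_complement G (set_inv A) (set_inv B)"
  unfolding minimal_left_complement_def
proof (intro conjI allI impI notI)
  have AB: "right_complement G A B" "A \<subseteq> carrier G" "B \<subseteq> carrier G"
    using assms by (auto simp: minimal_right_complement_def right_complement_def)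
  then show "left_complement G (set_inv A) (set_inv B)"
    using left_complement_set_inv by blast
  fix A' assume A': "A' \<subset> set_inv A" "left_complement G A' (set_inv B)"
  then have c: "A' \<subseteq> carrier G" by (auto simp: left_complement_def)
  have "set_inv A' \<subseteq> set_inv (set_inv A)"
    using A' by (auto simp: set_inv_eq_image)
  then have "set_inv A' \<subset> A"
    using A' AB c set_inv_set_inv by (metis psubset_eq)
  moreover have "right_complement G (set_inv A') B"
    using right_complement_set_inv[OF A'(2)] AB set_inv_set_inv by simp
  ultimately show False
    using assms by (auto simp: minimal_right_complement_def)
qed

text \<open>Inversion sends \<open>K #> x\<close> to \<open>inv x\<close> times \<open>K\<close>,
  which is again a right coset because \<open>K\<close> is normal in \<open>H\<close>. So the
  inverses of \<open>C\<close>, \<open>M\<close>, \<open>X\<close> and \<open>Y\<close> satisfy the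
  assumptions of the left version.\<close>

lemma not_minimal_right_complement:
  assumes H: "subgroup H G" and finH: "finite (rcosets H)"
    and K: "K \<lhd> (G\<lparr>carrier := H\<rparr>)"
    and C: "C \<subseteq> H" and KC: "\<And>k x. k \<in> K \<Longrightarrow> x \<in> C \<Longrightarrow> k \<otimes> x \<in> C"
    and Y: "finite Y" "Y \<subseteq> H" "H - C \<subseteq> (\<Union>y\<in>Y. K #> y)"
    and X: "X \<subseteq> C" "inj_on (\<lambda>x. K #> x) X" "2 * card (rcosets H) * card Y < card X"
    and M: "M \<subset> H" and E: "finite (C - M)"
    and cardK: "infinite K \<or> 2 * (card (rcosets H) + 1) * card (C - M) < card K"
  shows "\<not> minimal_right_complement G M B"
proof
  assume min: "minimal_right_complement G M B"
  have Hc: "H \<subseteq> carrier G" using H by (rule subgroup.subset)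
  have KH: "subgroup K (G\<lparr>carrier := H\<rparr>)" using K by (rule normal_imp_subgroup)
  have Ksub: "subgroup K G" using incl_subgroup[OF H KH] .
  have KsubH: "K \<subseteq> H" using subgroup.subset[OF KH] by simp
  have invH: "inv x \<in> H" "inv (inv x) = x" if "x \<in> H" for x
    using that H Hc by (auto intro: subgroup.m_inv_closed)
  have rcos_inv: "inv u \<in> K #> inv x" if xu: "x \<in> H" "u \<in> K #> x" for x u
  proof -
    obtain k where k: "k \<in> K" "u = k \<otimes> x" using xu by (auto simp: r_coset_def)
    have "inv x \<otimes> inv k \<otimes> x \<in> K"
      using normal.inv_op_closed1[OF K, of x "inv k"] subgroup.m_inv_closed[OF Ksub k(1)] that H
      by simp
    moreover have "inv u = (inv x \<otimes> inv k \<otimes> x) \<otimes> inv x"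
      using k that Hc KsubH by (auto simp: m_assoc inv_mult_group subset_iff)
    ultimately show ?thesis by (auto simp: r_coset_def)
  qed
  have mem_inv: "x \<in> set_inv A \<longleftrightarrow> inv x \<in> A" if "A \<subseteq> H" "x \<in> H" for A x
    using that invH by (force simp: set_inv_eq_image)
  have inv_sub: "set_inv A \<subseteq> H" if "A \<subseteq> H" for A
    using that invH by (auto simp: set_inv_eq_image)
  have diff: "set_inv C - set_inv M = set_inv (C - M)"
  proof -
    have "inj_on (\<lambda>x. inv x) H" using invH(2) by (rule inj_on_inverseI)
    moreover have "C - M \<subseteq> H" "M \<subseteq> H" using C M by auto
    ultimately show ?thesis
      unfolding set_inv_eq_image by (rule inj_on_image_set_diff[symmetric])
  qed
  have XH: "X \<subseteq> H" using X C by simp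
  have injX: "x = y" if "x \<in> X" "y \<in> X" "K #> inv x = K #> inv y" for x y
  proof -
    have xy: "x \<in> H" "y \<in> H" using that XH by auto
    have "inv x \<in> K #> inv y"
      using that xy Hc invH Ksub rcos_self by (metis subsetD)
    then have "x \<in> K #> y"
      using rcos_inv[of "inv y" "inv x"] xy invH by simp
    then have "K #> y = K #> x"
      using xy Hc Ksub by (intro repr_independence) auto
    then show ?thesis using X(2) that by (auto simp: inj_on_def)
  qed
  have "\<not> minimal_left_complement G (set_inv M) (set_inv B)"
  proof (rule not_minimal_left_complement[OF H finH Ksub KsubH])
    fix k x assume kx: "k \<in> K" "x \<in> set_inv C"
    then have x: "x \<in> H" "inv x \<in> C" using inv_sub[OF C] mem_inv[OF C] by auto
    have "k \<otimes> x \<in> K #> x" using kx by (auto simp: r_coset_def)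
    then have "inv (k \<otimes> x) \<in> K #> inv x" using x rcos_inv by simp
    then have "inv (k \<otimes> x) \<in> C" using KC x by (auto simp: r_coset_def)
    then show "k \<otimes> x \<in> set_inv C"
      using mem_inv[OF C, of "k \<otimes> x"] kx x KsubH H by (auto intro: subgroup.m_closed)
  next
    show "H - set_inv C \<subseteq> (\<Union>y\<in>set_inv Y. K #> y)"
    proof
      fix z assume z: "z \<in> H - set_inv C"
      then have "inv z \<in> H - C" using mem_inv[OF C] invH by auto
      then obtain y where y: "y \<in> Y" "inv z \<in> K #> y" using Y(3) by blast
      then have "z \<in> K #> inv y" using rcos_inv[of y "inv z"] Y(2) z invH by auto
      then show "z \<in> (\<Union>y\<in>set_inv Y. K #> y)" using y by (auto simp: set_inv_eq_image)
    qed
  next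
    show "set_inv X \<subseteq> set_inv C" using X(1) by (auto simp: set_inv_eq_image)
    show "inj_on (\<lambda>x. K #> x) (set_inv X)"
      using injX by (auto simp: set_inv_eq_image inj_on_def)
    have "card (set_inv X) = card X"
      unfolding set_inv_eq_image using injX by (intro card_image) (auto simp: inj_on_def)
    moreover have "card (set_inv Y) \<le> card Y"
      unfolding set_inv_eq_image using Y(1) by (rule card_image_le)
    then have "2 * card (rcosets H) * card (set_inv Y) \<le> 2 * card (rcosets H) * card Y"
      by (rule mult_le_mono2)
    ultimately show "2 * card (rcosets H) * card (set_inv Y) < card (set_inv X)"
      using X(3) by linarith
  next
    obtain y where y: "y \<in> H" "y \<notin> M" using M by auto
    then have "inv y \<notin> set_inv M"
      using mem_inv[of M "inv y"] invH(1)[OF y(1)] invH(2)[OF y(1)] M by simp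
    then show "set_inv M \<subset> H" using inv_sub[of M] M invH(1)[OF y(1)] by blast
  next
    have "card (set_inv (C - M)) \<le> card (C - M)"
      unfolding set_inv_eq_image using E by (rule card_image_le)
    then have "2 * (card (rcosets H) + 1) * card (set_inv (C - M))
        \<le> 2 * (card (rcosets H) + 1) * card (C - M)"
      by (rule mult_le_mono2)
    then show "infinite K \<or> 2 * (card (rcosets H) + 1) * card (set_inv C - set_inv M) < card K"
      using cardK unfolding diff by linarith
  next
    show "finite (set_inv C - set_inv M)"
      unfolding diff unfolding set_inv_eq_image using E by (rule finite_imageI)
  qed (use C Y inv_sub in \<open>auto simp: set_inv_eq_image\<close>)
  then show False using minimal_left_complement_set_inv[OF min] by simp
qed

end

section \<open>From the coset hypotheses to representatives\<close>

theorem theorem2p7: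
  fixes G (structure) and H K C E F :: "'a set"
  assumes "group G"
    and "subgroup H G"
    and "finite (rcosets H)"
    and "K \<lhd> (G\<lparr>carrier := H\<rparr>)"
    and "C \<subset> H"
    and "\<exists>\<S> \<subseteq> rcosets K. C = \<Union>\<S>"
    and "\<exists>\<S> \<subseteq> rcosets K. finite \<S> \<and> H - C = \<Union>\<S>"
    and "num_rcosets_in G K C > enat (2 * card (rcosets H)) * num_rcosets_in G K (H - C)"
    and "finite E" and "E \<subseteq> C"
    and "F \<subseteq> H - C"
    and "F = {} \<or> (\<exists>R \<in> rcosets K. F \<subseteq> R)"
    and "\<And>X. X \<subseteq> H \<Longrightarrow> finite X \<Longrightarrow> card X \<le> 2 * (card (rcosets H) + 1) * card E
           \<Longrightarrow> \<not> (\<exists>R \<in> rcosets K. R \<subseteq> F \<union> X)"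
    and "\<not> (\<exists>R \<in> rcosets K. R \<subseteq> E <#> set_inv F)"
  shows "\<not> minimal_complement G ((C - E) \<union> F)"
proof -
  interpret group G by fact
  note H = assms(2) and finH = assms(3) and K = assms(4)
  have Hc: "H \<subseteq> carrier G" using H by (rule subgroup.subset)
  have KH: "subgroup K (G\<lparr>carrier := H\<rparr>)" using K by (rule normal_imp_subgroup)
  have Ksub: "subgroup K G" using incl_subgroup[OF H KH] .
  have KsubH: "K \<subseteq> H" using subgroup.subset[OF KH] by simp
  have KC: "k \<otimes> x \<in> C" if kx: "k \<in> K" "x \<in> C" for k x
  proof -
    obtain R where R: "R \<in> rcosets K" "x \<in> R" "R \<subseteq> C" using assms(6) kx by blast
    then obtain a where "a \<in> carrier G" "R = K #> a" by (auto simp: RCOSETS_def)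
    then have "R = K #> x" using R Ksub by (metis repr_independence)
    moreover have "k \<otimes> x \<in> K #> x" using kx by (auto simp: r_coset_def)
    ultimately show ?thesis using R by blast
  qed
  obtain a where a: "\<And>R. R \<in> rcosets K \<Longrightarrow> a R \<in> carrier G \<and> R = K #> a R"
    unfolding RCOSETS_def by (metis (no_types, lifting) UN_E singletonD)
  have a_mem: "a R \<in> R" if "R \<in> rcosets K" for R
    using a[OF that] Ksub rcos_self by metis
  define P where "P = (\<lambda>A. {R \<in> rcosets K. R \<subseteq> A})"
  \<comment> \<open>In \<open>enat\<close> the product of \<open>0\<close> and
    \<open>\<infinity>\<close> is \<open>0\<close>; with a nonzero factor, an infinite count in
    \<open>H - C\<close> would make the right-hand side of the strict inequality infinite.\<close>
  have "card (rcosets H) \<noteq> 0"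
    using finH rcosetsI[OF Hc one_closed] by auto
  then have finD: "finite (P (H - C))"
    using assms(8) by (auto simp: num_rcosets_in_def P_def times_enat_def split: if_splits)
  have "infinite (P C) \<or> 2 * card (rcosets H) * card (P (H - C)) < card (P C)"
    using assms(8) finD by (auto simp: num_rcosets_in_def P_def split: if_splits)
  \<comment> \<open>The family \<open>P C\<close> may be infinite; a sufficiently large finite part
    of it then serves.\<close>
  then obtain Q where Q: "Q \<subseteq> P C" "2 * card (rcosets H) * card (P (H - C)) < card Q"
    using infinite_arbitrarily_large[of "P C" "Suc (2 * card (rcosets H) * card (P (H - C)))"]
    by (metis lessI subset_refl)
  define X where "X = a ` Q"
  define Y where "Y = a ` P (H - C)"
  define M where "M = (C - E) \<union> F"
  have aQ: "K #> a R = R" if "R \<in> Q" for R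
    using that Q(1) a[of R] by (auto simp: P_def)
  then have inj: "inj_on a Q" by (rule inj_on_inverseI)
  have X: "X \<subseteq> C" using Q(1) a_mem by (auto simp: X_def P_def)
  have injX: "inj_on (\<lambda>x. K #> x) X"
    unfolding X_def by (rule inj_on_inverseI[where g = a]) (use aQ in auto)
  have "card Y \<le> card (P (H - C))" unfolding Y_def using finD by (rule card_image_le)
  then have "2 * card (rcosets H) * card Y \<le> 2 * card (rcosets H) * card (P (H - C))"
    by (rule mult_le_mono2)
  then have cardX: "2 * card (rcosets H) * card Y < card X"
    using Q(2) card_image[OF inj] unfolding X_def by linarith
  have Y: "finite Y" "Y \<subseteq> H" using finD a_mem by (auto simp: Y_def P_def)
  have YD: "H - C \<subseteq> (\<Union>y\<in>Y. K #> y)"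
  proof
    fix z assume z: "z \<in> H - C"
    then obtain R where R: "R \<in> rcosets K" "z \<in> R" "R \<subseteq> H - C" using assms(7) by blast
    then have "a R \<in> Y" "z \<in> K #> a R" using a[OF R(1)] by (auto simp: Y_def P_def)
    then show "z \<in> (\<Union>y\<in>Y. K #> y)" by auto
  qed
  have CM: "C - M = E" using assms(10,11) by (auto simp: M_def)
  \<comment> \<open>Otherwise \<open>F\<close> would contain \<open>H - C\<close> and with it a
    whole coset of \<open>K\<close>, against (2) for the empty set.\<close>
  have "M \<noteq> H"
  proof
    assume "M = H"
    then have "H - C \<subseteq> F" by (auto simp: M_def)
    moreover obtain R where "R \<in> rcosets K" "R \<subseteq> H - C" using assms(5,7) by blast
    ultimately have "\<exists>R\<in>rcosets K. R \<subseteq> F \<union> {}" by blast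
    then show False using assms(13)[of "{}"] by simp
  qed
  then have M: "M \<subset> H" using assms(5,11) by (auto simp: M_def)
  have "K \<in> rcosets K"
    using subgroup.subgroup_in_rcosets[OF Ksub] group_axioms by auto
  \<comment> \<open>Condition (2) fails for \<open>K\<close> itself, as \<open>F \<union> K\<close>
    contains the coset \<open>K\<close>; so \<open>K\<close> must exceed the size bound.\<close>
  then have cardK: "infinite K \<or> 2 * (card (rcosets H) + 1) * card (C - M) < card K"
    using assms(13)[OF KsubH] unfolding CM by (metis Un_upper2 not_le)
  have E: "finite (C - M)" using CM assms(9) by simp
  have C: "C \<subseteq> H" using assms(5) by simp
  have "\<not> minimal_left_complement G M B" for B
    using not_minimal_left_complement[OF H finH Ksub KsubH C _ Y YD X injX cardX M E cardK] KC
    by simp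
  moreover have "\<not> minimal_right_complement G M B" for B
    using not_minimal_right_complement[OF H finH K C _ Y YD X injX cardX M E cardK] KC by simp
  ultimately show ?thesis
    unfolding minimal_complement_def M_def by blast
qed

end
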